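(* Let $q$ be an odd prime power and let $b\in\mathbb{F}_{q^8}^*$ with $b^2=-1$. Then the $\mathbb{F}_q$-subspace $$U_{b,1}=\{(x,bx^q+x^{q^5})\colon x\in\mathbb{F}_{q^8}\}$$ is maximum scattered in $\mathbb{F}_{q^8}\times\mathbb{F}_{q^8}$.
   Context: An $\mathbb{F}_q$-subspace $U$ of $\mathbb{F}_{q^m}\times\mathbb{F}_{q^m}$ is scattered if $\dim_{\mathbb{F}_q}(\langle \mathbf{v}\rangle_{\mathbb{F}_{q^m}}\cap U)\leq 1$ for every nonzero $\mathbf{v}\in\mathbb{F}_{q^m}\times\mathbb{F}_{q^m}$. It is maximum scattered if it is scattered and has the largest possible $\mathbb{F}_q$-dimension among scattered $\mathbb{F}_q$-subspaces of $\mathbb{F}_{q^m}\times\mathbb{F}_{q^m}$; this largest dimension is $m$. *)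

theory Defs
  imports
    "HOL-Number_Theory.Prime_Powers"
    "HOL-Library.Product_Plus"
    "HOL-Library.Cardinality"
begin

text \<open>
  The inclusion of the field with q elements in the field with q^m elements is an embedding
  \<open>\<iota>\<close> of a field type \<open>'k\<close> into a field type \<open>'a\<close>; thus the library notions
  of subspace, span and dimension, whose scalars range over a whole type, apply over both fields.
\<close>

definition field_embedding :: "('k::field \<Rightarrow> 'a::field) \<Rightarrow> bool" where
  "field_embedding \<iota> \<longleftrightarrow>
     \<iota> 1 = 1 \<and> (\<forall>x y. \<iota> (x + y) = \<iota> x + \<iota> y) \<and> (\<forall>x y. \<iota> (x * y) = \<iota> x * \<iota> y)"

text \<open>The product type has no scalar multiplication in the library; \<open>pair_scale id\<close> is
  multiplication by scalars from the big field itself.\<close>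

definition pair_scale :: "('k \<Rightarrow> 'a::field) \<Rightarrow> 'k \<Rightarrow> 'a \<times> 'a \<Rightarrow> 'a \<times> 'a" where
  "pair_scale \<iota> c v = (\<iota> c * fst v, \<iota> c * snd v)"

lemma field_embedding_id: "field_embedding id"
  by (simp add: field_embedding_def)

lemma vector_space_pair_scale:
  assumes "field_embedding \<iota>"
  shows "vector_space (pair_scale \<iota>)"
  using assms
  by unfold_locales (simp_all add: field_embedding_def pair_scale_def algebra_simps)

definition scattered :: "('k::field \<Rightarrow> 'a::field) \<Rightarrow> ('a \<times> 'a) set \<Rightarrow> bool" where
  "scattered \<iota> U \<longleftrightarrow>
     module.subspace (pair_scale \<iota>) U \<and>
     (\<forall>v. v \<noteq> 0 \<longrightarrow>
        vector_space.dim (pair_scale \<iota>) (module.span (pair_scale id) {v} \<inter> U) \<le> 1)"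

definition maximum_scattered :: "('k::field \<Rightarrow> 'a::field) \<Rightarrow> ('a \<times> 'a) set \<Rightarrow> bool" where
  "maximum_scattered \<iota> U \<longleftrightarrow>
     scattered \<iota> U \<and>
     (\<forall>W. scattered \<iota> W \<longrightarrow>
        vector_space.dim (pair_scale \<iota>) W \<le> vector_space.dim (pair_scale \<iota>) U)"

end

theory Submission
  imports Defs
    "HOL-Number_Theory.Residues"
    "HOL-Computational_Algebra.Polynomial"
begin

text \<open>
  Write \<open>\<phi>\<close> for the \<open>q\<close>-Frobenius, \<open>f x = b \<phi>(x) + \<phi>\<^sup>5(x)\<close>,
  and let \<open>f x = L x\<close> with \<open>x \<noteq> 0\<close>. Since \<open>\<phi>\<^sup>4\<close> fixes \<open>b\<close>, applying it gives a second equation,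
  and \<open>b\<^sup>2 = -1 \<noteq> 1\<close> lets one solve the two for \<open>\<phi>(x)\<close> in terms of \<open>x\<close> and \<open>\<phi>\<^sup>4(x)\<close>. So
  \<open>\<phi>\<^sup>2(x)\<close> is a combination of \<open>x\<close> and \<open>\<phi>\<^sup>4(x)\<close> in two ways: going up from \<open>x\<close>
  and going down from \<open>\<phi>\<^sup>4(x)\<close>. If two solutions \<open>x\<close>, \<open>y\<close> make \<open>(x, \<phi>\<^sup>4(x))\<close> and \<open>(y, \<phi>\<^sup>4(y))\<close>
  proportional, then \<open>y / x\<close> is fixed by \<open>\<phi>\<close>. Otherwise the two combinations have equal coefficients;
  these equations and their \<open>\<phi>\<^sup>4\<close>-conjugates force \<open>L = \<plusminus> \<phi>\<^sup>4(L)\<close>, which they also exclude.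

  Maximality is a count: the nonzero vectors of a scattered subspace of dimension \<open>d\<close> are spread over
  at most \<open>q\<^sup>m + 1\<close> lines with at most \<open>q - 1\<close> on each, so \<open>d \<le> m\<close>.
\<close>

section \<open>Elementary properties of field embeddings\<close>

lemma field_embedding_0: "field_embedding \<phi> \<Longrightarrow> \<phi> 0 = 0"
  unfolding field_embedding_def by (metis add_cancel_right_left)

lemma field_embedding_minus: "field_embedding \<phi> \<Longrightarrow> \<phi> (- x) = - \<phi> x"
  using field_embedding_0[of \<phi>] unfolding field_embedding_def
  by (metis add.right_inverse add_eq_0_iff)

lemma field_embedding_eq_0_iff: "field_embedding \<phi> \<Longrightarrow> \<phi> x = 0 \<longleftrightarrow> x = 0"
  using field_embedding_0[of \<phi>] unfolding field_embedding_def
  by (metis mult_zero_left right_inverse zero_neq_one)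

lemma field_embedding_inj: "field_embedding \<phi> \<Longrightarrow> inj \<phi>"
  using field_embedding_eq_0_iff[of \<phi>] field_embedding_minus[of \<phi>]
  unfolding field_embedding_def inj_def
  by (metis add.inverse_inverse add_eq_0_iff)

lemma field_embedding_funpow:
  fixes \<phi> :: "'a::field \<Rightarrow> 'a"
  shows "field_embedding \<phi> \<Longrightarrow> field_embedding (\<phi> ^^ n)"
  by (induction n) (simp_all add: field_embedding_def)

section \<open>Algebra of the conjugate equations\<close>

text \<open>Here \<open>l i\<close> stands for \<open>\<phi>\<^sup>i(L)\<close>, and \<open>e\<close> for the sign with \<open>\<phi>(b) = e b\<close>.\<close>

lemma conjugate_relations_contradiction:
  fixes l :: "nat \<Rightarrow> 'a::field"
  assumes two: "(2::'a) \<noteq> 0" and b: "b \<noteq> 0" and c: "c \<noteq> 0" and nz: "\<And>i. l i \<noteq> 0" and e: "e = 1 \<or> e = -1"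
    and sh: "\<And>i j n s. s = 1 \<or> s = - 1 \<Longrightarrow> l i = s * l j \<Longrightarrow> l (i + n) = s * l (j + n)"
    and per: "\<And>i. l (i + 8) = l i"
    and E1: "l 2 * l 3 * l 7 * l 0 * (l 5 - e * l 1) = c * b * (l 7 + e * l 3)"
    and E1': "l 6 * l 7 * l 3 * l 4 * (l 1 - e * l 5) = c * b * (l 3 + e * l 7)"
    and E2: "l 2 * l 3 * l 7 * b * l 4 * (e * l 1 + l 5) = - (c * (l 3 - e * l 7))"
    and E2': "l 6 * l 7 * l 3 * b * l 0 * (e * l 5 + l 1) = - (c * (l 7 - e * l 3))"
  shows False
proof -
  have ee: "e * e = 1" using e by auto
  \<comment> \<open>Equality kills the left side of \<open>E1\<close>; shifting it by 2 turns the
    right side into \<open>2 * c * b * l 7\<close>. The other sign is excluded in the same way by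
    \<open>E2\<close>.\<close>
  have n1: "l 5 \<noteq> e * l 1"
  proof
    assume h: "l 5 = e * l 1"
    have "l 7 = e * l 3" using sh[OF e h, of 2] by (simp add: eval_nat_numeral)
    then have "l 7 + e * l 3 = 2 * l 7" by (simp only: mult_2)
    moreover have "l 7 + e * l 3 = 0" using E1 h c b by simp
    ultimately show False using two nz by (metis mult_eq_0_iff)
  qed
  have n2: "l 5 \<noteq> - e * l 1"
  proof
    assume h: "l 5 = - e * l 1"
    have "l 7 = - e * l 3" using sh[OF _ h, of 2] e by (auto simp: eval_nat_numeral)
    then have "e * l 7 = - l 3" using ee by (metis add.inverse_inverse minus_mult_left mult.assoc mult_1 mult_minus_right)
    then have "l 3 - e * l 7 = 2 * l 3" by (simp only: mult_2 diff_minus_eq_add)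
    moreover have "l 3 - e * l 7 = 0" using E2 h c by simp
    ultimately show False using two nz by (metis mult_eq_0_iff)
  qed
  \<comment> \<open>In \<open>E1\<close> minus \<open>e\<close> times \<open>E1'\<close> the right
    sides cancel, and the left sides share the factor \<open>l 5 - e * l 1\<close>, nonzero by
    \<open>n1\<close>. Below, \<open>E2\<close> plus \<open>e\<close> times \<open>E2'\<close> is
    treated likewise with \<open>n2\<close>.\<close>
  have "l 3 * l 7 * (l 5 - e * l 1) * (l 0 * l 2 + l 4 * l 6)
      = l 2 * l 3 * l 7 * l 0 * (l 5 - e * l 1) - e * (l 6 * l 7 * l 3 * l 4 * (l 1 - e * l 5))"
    using e by (auto simp: algebra_simps)
  also have "\<dots> = 0"
    unfolding E1 E1' using e by (auto simp: algebra_simps)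
  finally have "l 3 * l 7 * (l 5 - e * l 1) * (l 0 * l 2 + l 4 * l 6) = 0" .
  then have p1: "l 0 * l 2 = - (l 4 * l 6)"
    using n1 nz by (simp add: add_eq_0_iff2)
  have "l 3 * l 7 * b * (l 5 + e * l 1) * (l 2 * l 4 + l 0 * l 6)
      = l 2 * l 3 * l 7 * b * l 4 * (e * l 1 + l 5) + e * (l 6 * l 7 * l 3 * b * l 0 * (e * l 5 + l 1))"
    using e by (auto simp: algebra_simps)
  also have "\<dots> = 0"
    unfolding E2 E2' using e by (auto simp: algebra_simps)
  finally have "l 3 * l 7 * b * (l 5 + e * l 1) * (l 2 * l 4 + l 0 * l 6) = 0" .
  moreover have "l 5 + e * l 1 \<noteq> 0" using n2 by (simp add: add_eq_0_iff2)
  ultimately have p2: "l 2 * l 4 = - (l 0 * l 6)"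
    using b nz by (simp add: add_eq_0_iff2)
  \<comment> \<open>Multiplying \<open>p1\<close> by \<open>p2\<close> gives equal squares of
    \<open>l 2\<close> and \<open>l 6\<close>.\<close>
  have "l 0 * l 4 * ((l 2 - l 6) * (l 2 + l 6)) = (l 0 * l 2) * (l 2 * l 4) - (l 4 * l 6) * (l 0 * l 6)"
    by (simp add: algebra_simps)
  also have "\<dots> = 0" by (simp add: p1 p2)
  finally have "l 0 * l 4 * ((l 2 - l 6) * (l 2 + l 6)) = 0" .
  then have "l 2 = l 6 \<or> l 2 = - l 6"
    using nz by (simp add: add_eq_0_iff2)
  then obtain s where s: "s = 1 \<or> s = -1" "l 2 = s * l 6" by force
  \<comment> \<open>The shift by 3 reaches \<open>l 9 = l 1\<close>; both signs are excluded, since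
    \<open>e\<close> and \<open>- e\<close> are 1 and -1 in some order.\<close>
  have "l 5 = s * l 1" using sh[OF s, of 3] per[of 1] by (simp add: eval_nat_numeral)
  then show False using n1 n2 s(1) e by auto
qed

text \<open>Cramer's rule: the system in \<open>u\<close>, \<open>v\<close> has determinant
  \<open>b * b - 1 = - 2\<close>.\<close>

lemma solve_conjugate_pair:
  fixes b :: "'a::comm_ring_1"
  assumes "b * b = - 1" "b * u + v = r" "b * v + u = s"
  shows "2 * u = s - b * r"
proof -
  have "s - b * r = u - b * b * u"
    unfolding assms(2,3)[symmetric] by (simp add: algebra_simps)
  then show ?thesis by (simp add: assms(1))
qed

text \<open>This is the core of scatteredness: \<open>eq\<close> says that the graph points over
  \<open>x\<close> and \<open>y\<close> lie on one line through 0, and a quotient fixed by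
  \<open>\<phi>\<close> is a scalar of the small field.\<close>

lemma frobenius_fixes_quotient:
  fixes \<phi> :: "'a::field \<Rightarrow> 'a"
  assumes emb: "field_embedding \<phi>" and cyc: "\<And>z. (\<phi> ^^ 8) z = z"
    and two: "(2::'a) \<noteq> 0" and b2: "b ^ 2 = - 1" and x: "x \<noteq> 0"
    and eq: "x * (b * \<phi> y + (\<phi> ^^ 5) y) = y * (b * \<phi> x + (\<phi> ^^ 5) x)"
  shows "\<phi> (y / x) = y / x"
proof -
  note e0 = field_embedding_0[OF emb] and em = field_embedding_minus[OF emb]
    and enz = field_embedding_eq_0_iff[OF emb]
  have ea: "\<phi> (u + v) = \<phi> u + \<phi> v" and ep: "\<phi> (u * v) = \<phi> u * \<phi> v" and e1: "\<phi> 1 = 1" for u v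
    using emb by (auto simp: field_embedding_def)
  have b: "b \<noteq> 0" using b2 by auto
  have four: "(4::'a) \<noteq> 0"
    using two by (metis mult_2 mult_eq_0_iff numeral_Bit0)
  have "\<phi> b * \<phi> b = b * b"
    using b2 ep[of b b] em[of 1] e1 by (simp add: power2_eq_square)
  then have "\<phi> b = b \<or> \<phi> b = - b" by (simp add: square_eq_iff)
  then obtain e where e: "e = 1 \<or> e = -1" and \<phi>b: "\<phi> b = e * b" by force
  have \<phi>e: "\<phi> e = e" using e em[of 1] e1 by auto
  have ee: "e * e = 1" using e by auto
  define X where "X = (\<lambda>i. (\<phi> ^^ i) x)"
  define Y where "Y = (\<lambda>i. (\<phi> ^^ i) y)"
  define L where "L = (b * X 1 + X 5) / x"
  define l where "l = (\<lambda>i. (\<phi> ^^ i) L)"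
  have S: "\<phi> (X i) = X (Suc i)" "\<phi> (Y i) = Y (Suc i)" "\<phi> (l i) = l (Suc i)" for i
    by (simp_all add: X_def Y_def l_def)
  have per: "X (i + 8) = X i" "Y (i + 8) = Y i" "l (i + 8) = l i" for i
    by (simp_all only: X_def Y_def l_def funpow_add o_apply cyc)
  \<comment> \<open>Repeated use of \<open>\<phi>\<close> on one equation yields its eight
    conjugates: the coefficient alternates between \<open>b\<close> and \<open>e * b\<close> because
    \<open>e * e = 1\<close>, and indices are read modulo 8. It is stated for any \<open>Z\<close>
    to serve both \<open>X\<close> and \<open>Y\<close>.\<close>
  have rel: "(b * Z 1 + Z 5 = l 0 * Z 0) \<Longrightarrow>
      b * Z 1 + Z 5 = l 0 * Z 0 \<and> e * b * Z 2 + Z 6 = l 1 * Z 1 \<and> b * Z 3 + Z 7 = l 2 * Z 2 \<and>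
      e * b * Z 4 + Z 0 = l 3 * Z 3 \<and> b * Z 5 + Z 1 = l 4 * Z 4 \<and> e * b * Z 6 + Z 2 = l 5 * Z 5 \<and>
      b * Z 7 + Z 3 = l 6 * Z 6 \<and> e * b * Z 0 + Z 4 = l 7 * Z 7"
    if SZ: "\<And>i. \<phi> (Z i) = Z (Suc i)" and perZ: "\<And>i. Z (i + 8) = Z i" for Z
  proof -
    assume r0: "b * Z 1 + Z 5 = l 0 * Z 0"
    have odd: "e * b * Z (i + 2) + Z (i + 6) = l (i + 1) * Z (i + 1)"
      if "b * Z (i + 1) + Z (i + 5) = l i * Z i" for i
      using arg_cong[OF that, of \<phi>] by (simp add: ea ep SZ S \<phi>b eval_nat_numeral)
    have even: "b * Z (i + 3) + Z (i + 7) = l (i + 2) * Z (i + 2)"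
      if "b * Z (i + 1) + Z (i + 5) = l i * Z i" for i
    proof -
      have "e * (e * b) * Z (i + 3) + Z (i + 7) = l (i + 2) * Z (i + 2)"
        using arg_cong[OF odd[OF that], of \<phi>] by (simp add: ea ep SZ S \<phi>b \<phi>e eval_nat_numeral)
      then show ?thesis using ee by (simp flip: mult.assoc)
    qed
    have p: "Z 8 = Z 0" "Z 9 = Z 1" "Z 10 = Z 2" "Z 11 = Z 3" "Z 12 = Z 4"
      using perZ[of 0] perZ[of 1] perZ[of 2] perZ[of 3] perZ[of 4] by simp_all
    have r2: "b * Z 3 + Z 7 = l 2 * Z 2" using even[of 0] r0 by (simp add: eval_nat_numeral)
    have r4: "b * Z 5 + Z 1 = l 4 * Z 4" using even[of 2] r2 p by simp
    have r6: "b * Z 7 + Z 3 = l 6 * Z 6" using even[of 4] r4 p by simp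
    show ?thesis
      using r0 r2 r4 r6 odd[of 0] odd[of 2] odd[of 4] odd[of 6] p by (simp add: eval_nat_numeral)
  qed
  have rX0: "b * X 1 + X 5 = l 0 * X 0" using x by (simp add: l_def L_def X_def)
  have rY0: "b * Y 1 + Y 5 = l 0 * Y 0"
    using eq x by (simp add: l_def L_def X_def Y_def field_simps)
  note rX = rel[OF S(1) per(1) rX0] and rY = rel[OF S(2) per(2) rY0]
  have Xnz: "X i \<noteq> 0" for i
    by (induction i) (use x enz S(1) in \<open>auto simp: X_def\<close>)
  have bb: "b * b = - 1" using b2 by (simp add: power2_eq_square)
  have bb': "b * (b * z) = - z" for z by (simp add: bb flip: mult.assoc)
  \<comment> \<open>For slope 0 the equations with indices 0 and 4 give
    \<open>X 1 = b * (b * X 1) = - X 1\<close>.\<close>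
  have "L \<noteq> 0"
  proof
    assume "L = 0"
    then have "l i = 0" for i by (induction i) (use e0 S(3) in \<open>auto simp: l_def\<close>)
    then have "b * X 1 + X 5 = 0" "b * X 5 + X 1 = 0" using rX by auto
    then have "X 1 = b * (b * X 1)" by (metis add.inverse_unique add.commute add_eq_0_iff minus_mult_right)
    then have "2 * X 1 = 0" using bb by (simp flip: mult.assoc)
    then show False using two Xnz by simp
  qed
  then have lnz: "l i \<noteq> 0" for i
    by (induction i) (use enz S(3) in \<open>auto simp: l_def\<close>)
  show ?thesis
  proof (cases "X 0 * Y 4 = Y 0 * X 4")
    case True
    \<comment> \<open>\<open>X 1\<close> and \<open>Y 1\<close> are the same combination of entries
      0 and 4, so proportionality of those entries passes to entries 0 and 1.\<close>
    have X1: "2 * X 1 = l 4 * X 4 - b * (l 0 * X 0)" and Y1: "2 * Y 1 = l 4 * Y 4 - b * (l 0 * Y 0)"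
      using solve_conjugate_pair[OF bb] rX rY by blast+
    have "X 0 * (2 * Y 1) = Y 0 * (2 * X 1)"
      unfolding X1 Y1 using arg_cong[OF True, of "(*) (l 4)"] by (simp add: algebra_simps)
    then have "x * \<phi> y = y * \<phi> x" using two by (simp add: X_def Y_def)
    moreover have "\<phi> y = \<phi> (y / x) * \<phi> x" using x by (simp flip: ep)
    ultimately show ?thesis using x enz[of x] by (simp add: field_simps)
  next
    case False
    \<comment> \<open>\<open>P * Z 0 = R * Z 4\<close> is what remains after equating two values of
      \<open>4 * l 2 * l 3 * l 7 * Z 2\<close>: one solves upwards through \<open>Z 1\<close> and
      \<open>Z 5\<close>, the other descends through \<open>Z 3\<close> and
      \<open>Z 7\<close>.\<close>
    define P where "P = l 2 * l 3 * l 7 * l 0 * (l 5 - e * l 1) - 4 * b * (l 7 + e * l 3)"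
    define R where "R = l 2 * l 3 * l 7 * b * l 4 * (e * l 1 + l 5) + 4 * (l 3 - e * l 7)"
    have lin: "P * Z 0 = R * Z 4"
      if r: "b * Z 1 + Z 5 = l 0 * Z 0 \<and> e * b * Z 2 + Z 6 = l 1 * Z 1 \<and> b * Z 3 + Z 7 = l 2 * Z 2 \<and>
      e * b * Z 4 + Z 0 = l 3 * Z 3 \<and> b * Z 5 + Z 1 = l 4 * Z 4 \<and> e * b * Z 6 + Z 2 = l 5 * Z 5 \<and>
      b * Z 7 + Z 3 = l 6 * Z 6 \<and> e * b * Z 0 + Z 4 = l 7 * Z 7" for Z :: "nat \<Rightarrow> 'a"
    proof -
      have ebb: "(e * b) * (e * b) = - 1" using e bb by auto
      have a1: "2 * Z 1 = l 4 * Z 4 - b * (l 0 * Z 0)" "2 * Z 5 = l 0 * Z 0 - b * (l 4 * Z 4)"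
        and a2: "2 * Z 2 = l 5 * Z 5 - e * b * (l 1 * Z 1)"
        using solve_conjugate_pair[OF bb] solve_conjugate_pair[OF ebb] r by blast+
      have "4 * Z 2 = 2 * (2 * Z 2)" by simp
      also have "\<dots> = l 5 * (2 * Z 5) - e * b * (l 1 * (2 * Z 1))"
        unfolding a2 by (simp add: algebra_simps)
      also have "\<dots> = l 0 * (l 5 - e * l 1) * Z 0 - b * l 4 * (e * l 1 + l 5) * Z 4"
        unfolding a1 by (simp add: algebra_simps bb')
      finally have a3: "l 0 * (l 5 - e * l 1) * Z 0 - b * l 4 * (e * l 1 + l 5) * Z 4 = 4 * Z 2" ..
      have "l 2 * l 3 * l 7 * Z 2 = l 3 * l 7 * (l 2 * Z 2)"
        by (simp add: ac_simps)
      also have "\<dots> = l 3 * l 7 * (b * Z 3 + Z 7)"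
        using r by simp
      also have "\<dots> = l 7 * b * (l 3 * Z 3) + l 3 * (l 7 * Z 7)"
        by (simp add: algebra_simps)
      also have "\<dots> = l 7 * b * (e * b * Z 4 + Z 0) + l 3 * (e * b * Z 0 + Z 4)"
        using r by simp
      also have "\<dots> = b * (l 7 + e * l 3) * Z 0 + (l 3 - e * l 7) * Z 4"
        by (simp add: algebra_simps bb')
      finally have "l 2 * l 3 * l 7 * (4 * Z 2) = 4 * (b * (l 7 + e * l 3) * Z 0 + (l 3 - e * l 7) * Z 4)"
        by (simp add: ac_simps)
      then show ?thesis unfolding P_def R_def a3[symmetric] by (simp add: algebra_simps)
    qed
    \<comment> \<open>A linear relation with two independent solutions \<open>(X 0, X 4)\<close> and
      \<open>(Y 0, Y 4)\<close> has zero coefficients.\<close>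
    have "P * (X 0 * Y 4 - Y 0 * X 4) = (P * X 0) * Y 4 - (P * Y 0) * X 4"
      by (simp add: algebra_simps)
    also have "\<dots> = 0" unfolding lin[OF rX] lin[OF rY] by (simp add: ac_simps)
    finally have "P = 0" using False by simp
    have "R * (X 0 * Y 4 - Y 0 * X 4) = X 0 * (R * Y 4) - Y 0 * (R * X 4)"
      by (simp add: algebra_simps)
    also have "\<dots> = 0" unfolding lin[OF rX, symmetric] lin[OF rY, symmetric] by (simp add: ac_simps)
    finally have "R = 0" using False by simp
    then have E: "l 2 * l 3 * l 7 * l 0 * (l 5 - e * l 1) = 4 * b * (l 7 + e * l 3)"
      "l 2 * l 3 * l 7 * b * l 4 * (e * l 1 + l 5) = - (4 * (l 3 - e * l 7))"
      using \<open>P = 0\<close> \<open>R = 0\<close> by (simp_all add: P_def R_def add_eq_0_iff2)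
    define \<tau> where "\<tau> = \<phi> ^^ 4"
    have \<tau>: "field_embedding \<tau>" unfolding \<tau>_def by (rule field_embedding_funpow[OF emb])
    have ta: "\<tau> (u + v) = \<tau> u + \<tau> v" and tp: "\<tau> (u * v) = \<tau> u * \<tau> v" and t1: "\<tau> 1 = 1" for u v
      using \<tau> by (auto simp: field_embedding_def)
    have tm: "\<tau> (- u) = - \<tau> u" for u using field_embedding_minus[OF \<tau>] .
    have td: "\<tau> (u - v) = \<tau> u - \<tau> v" for u v
      using ta[of u "- v"] tm[of v] by simp
    have t4: "\<tau> 4 = 4" using t1 ta[of 1 1] ta[of "1 + 1" "1 + 1"] by simp
    have te: "\<tau> e = e" using e t1 tm[of 1] by auto
    \<comment> \<open>Four sign changes by \<open>e\<close> cancel.\<close>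
    have tb: "\<tau> b = b" using e by (auto simp: \<tau>_def eval_nat_numeral \<phi>b em)
    have tl: "\<tau> (l i) = l (4 + i)" for i by (simp add: \<tau>_def l_def funpow_add)
    have w: "l 8 = l 0" "l 9 = l 1" "l 10 = l 2" "l 11 = l 3"
      using per(3)[of 0] per(3)[of 1] per(3)[of 2] per(3)[of 3] by simp_all
    have E': "l 6 * l 7 * l 3 * l 4 * (l 1 - e * l 5) = 4 * b * (l 3 + e * l 7)"
      "l 6 * l 7 * l 3 * b * l 0 * (e * l 5 + l 1) = - (4 * (l 7 - e * l 3))"
      using arg_cong[OF E(1), of \<tau>] arg_cong[OF E(2), of \<tau>]
      by (simp_all add: ta tp tm td te tb tl t4 w)
    have sh: "l (i + n) = s * l (j + n)" if "s = 1 \<or> s = - 1" "l i = s * l j" for i j n s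
    proof (induction n)
      case (Suc n)
      have "\<phi> s = s" using that(1) em[of 1] e1 by auto
      then show ?case using arg_cong[OF Suc, of \<phi>] by (simp add: S ep)
    qed (use that in simp)
    show ?thesis
      using conjugate_relations_contradiction[of b 4 l e, OF two b four lnz e sh per(3) E(1) E'(1) E(2) E'(2)] by blast
  qed
qed

section \<open>Counting vectors in subspaces\<close>

text \<open>Each vector of the span enlarged by \<open>a\<close> is uniquely
  \<open>k *s a + v\<close> with \<open>v\<close> in the old span, so each basis vector contributes
  a factor \<open>CARD('a)\<close>.\<close>

lemma (in vector_space) card_span_independent:
  assumes "finite B" "independent B"
  shows "card (span B) = CARD('a) ^ card B"
  using assms
proof (induction B)
  case (insert a B)
  have a: "a \<notin> span B" and B: "independent B"
    using insert by (auto simp: independent_insert)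
  define g where "g = (\<lambda>(k, v). scale k a + v)"
  have "inj_on g (UNIV \<times> span B)"
  proof (rule inj_onI, clarsimp simp: g_def)
    fix k v k' v' assume v: "v \<in> span B" "v' \<in> span B" and eq: "k *s a + v = k' *s a + v'"
    have "(k - k') *s a = v' - v" using eq by (simp add: algebra_simps)
    then have "(k - k') *s a \<in> span B" using v by (simp add: span_diff)
    then have "inverse (k - k') *s ((k - k') *s a) \<in> span B" by (rule span_scale)
    then have "k = k'" using a by (cases "k = k'") simp_all
    then show "k = k' \<and> v = v'" using eq by simp
  qed
  moreover have "g ` (UNIV \<times> span B) = span (insert a B)"
  proof (rule equalityI; rule subsetI)
    fix x assume "x \<in> span (insert a B)"
    then obtain k where "x - k *s a \<in> span B" by (auto simp: span_insert)
    then have "(k, x - k *s a) \<in> UNIV \<times> span B" "g (k, x - k *s a) = x" by (simp_all add: g_def)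
    then show "x \<in> g ` (UNIV \<times> span B)" by (metis image_eqI)
  next
    fix x assume "x \<in> g ` (UNIV \<times> span B)"
    then obtain k v where "x = k *s a + v" "v \<in> span B" by (auto simp: g_def)
    then have "x - k *s a \<in> span B" by simp
    then show "x \<in> span (insert a B)" by (auto simp: span_insert)
  qed
  ultimately have "card (span (insert a B)) = CARD('a) * card (span B)"
    by (metis card_cartesian_product card_image)
  then show ?case using insert B by simp
qed simp

lemma (in vector_space) card_subspace:
  assumes "subspace V" "finite V"
  shows "card V = CARD('a) ^ dim V"
proof -
  obtain B where B: "B \<subseteq> V" "independent B" "V \<subseteq> span B" "card B = dim V"
    by (rule basis_exists)
  moreover have "span B = V" using B assms(1) span_minimal by blast
  ultimately show ?thesis
    using card_span_independent[of B] finite_subset[OF B(1) assms(2)] by simp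
qed

section \<open>Frobenius maps and subfields of finite fields\<close>

text \<open>Multiplication by a nonzero \<open>x\<close> permutes the nonzero elements; comparing
  their products gives Fermat's identity.\<close>

lemma finite_field_power_CARD:
  fixes x :: "'a::{field,finite}"
  shows "x ^ CARD('a) = x"
proof (cases "x = 0")
  case False
  let ?U = "UNIV - {0::'a}"
  have "bij_betw ((*) x) ?U ?U"
    by (rule bij_betw_byWitness[where f' = "\<lambda>y. y / x"]) (use False in auto)
  then have "prod id ?U = (\<Prod>y\<in>?U. x * y)"
    by (subst prod.reindex_bij_betw[symmetric]) auto
  then have "x ^ card ?U = 1"
    by (simp add: prod.distrib)
  moreover have "CARD('a) = Suc (card ?U)"
    by (simp add: card_Suc_Diff1)
  ultimately show ?thesis by (simp only: power_Suc mult_1_right)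
qed (simp add: zero_power)

text \<open>The characteristic is a prime dividing a power of \<open>p\<close>, hence is
  \<open>p\<close>; additivity is then the freshman's dream.\<close>

lemma field_embedding_power_card:
  assumes "primepow q" "CARD('a::{field,finite}) = q ^ m" "m > 0"
  shows "field_embedding (\<lambda>x::'a. x ^ q)"
proof -
  obtain p k where pk: "prime p" "k > 0" "q = p ^ k"
    using assms(1) by (auto simp: primepow_def)
  have c: "prime CHAR('a)"
    by (simp add: finite_imp_CHAR_pos prime_CHAR_semidom)
  have "CHAR('a) dvd p ^ (k * m)"
    using CHAR_dvd_CARD[where 'a = 'a] assms(2) pk(3) by (simp add: power_mult)
  then have "CHAR('a) = p"
    using c pk(1) by (metis prime_dvd_power primes_dvd_imp_eq)
  then have "(x + y) ^ q = x ^ q + y ^ q" for x y :: 'a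
    using freshmans_dream'[OF c, of q k] pk(3) by simp
  then show ?thesis by (simp add: field_embedding_def power_mult_distrib)
qed

lemma two_neq_0_of_odd_card:
  assumes "odd CARD('a::{field,finite})"
  shows "(2::'a) \<noteq> 0"
proof
  assume "(2::'a) = 0"
  then have "CHAR('a) dvd 2"
    using of_nat_eq_0_iff_char_dvd[where 'a = 'a, of 2] by simp
  then have "CHAR('a) = 2"
    using finite_imp_CHAR_pos[where 'a = 'a] prime_CHAR_semidom[where 'a = 'a]
    by (intro primes_dvd_imp_eq) auto
  then show False using CHAR_dvd_CARD[where 'a = 'a] assms by simp
qed

text \<open>The polynomial \<open>p\<close>, of degree \<open>CARD('k)\<close>, has at most that
  many roots, and the injective \<open>\<iota>\<close> already supplies as many.\<close>

lemma range_eq_fixed_points: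
  fixes \<iota> :: "'k::{field,finite} \<Rightarrow> 'a::field"
  assumes "field_embedding \<iota>"
  shows "range \<iota> = {x. x ^ CARD('k) = x}"
proof -
  let ?q = "CARD('k)"
  have q: "?q > 1" using card_mono[of UNIV "{0, 1::'k}"] by simp
  define p where "p = monom (1::'a) ?q - [:0, 1:]"
  have d: "degree p = ?q" "p \<noteq> 0"
  proof -
    have "degree p = degree (monom (1::'a) ?q)"
      unfolding p_def diff_conv_add_uminus
      by (rule degree_add_eq_left) (use q in \<open>simp add: degree_monom_eq\<close>)
    then show "degree p = ?q" by (simp add: degree_monom_eq)
    then show "p \<noteq> 0" using q by auto
  qed
  have roots: "{x. poly p x = 0} = {x. x ^ ?q = x}"
    by (simp add: p_def poly_monom)
  have "\<iota> (x ^ n) = \<iota> x ^ n" for x :: 'k and n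
    using assms by (induction n) (simp_all add: field_embedding_def)
  then have sub: "range \<iota> \<subseteq> {x. x ^ ?q = x}"
    by (auto simp: finite_field_power_CARD simp flip: \<open>\<And>x n. \<iota> (x ^ n) = \<iota> x ^ n\<close>)
  show ?thesis
  proof (rule card_seteq[OF _ sub])
    show "finite {x::'a. x ^ ?q = x}"
      using poly_roots_finite[OF d(2)] roots by simp
    show "card {x::'a. x ^ ?q = x} \<le> card (range \<iota>)"
      using card_poly_roots_bound[OF d(2)] roots d(1) card_image[OF field_embedding_inj[OF assms]] by simp
  qed
qed

section \<open>The dimension bound for scattered subspaces\<close>

lemma scattered_dim_le:
  fixes \<iota> :: "'k::{field,finite} \<Rightarrow> 'a::{field,finite}"
  assumes emb: "field_embedding \<iota>" and card: "CARD('a) = CARD('k) ^ m" and m: "m \<ge> 2"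
    and W: "scattered \<iota> W"
  shows "vector_space.dim (pair_scale \<iota>) W \<le> m"
proof (rule ccontr)
  interpret K: vector_space "pair_scale \<iota>" by (rule vector_space_pair_scale[OF emb])
  interpret A: vector_space "pair_scale id :: 'a \<Rightarrow> _"
    by (rule vector_space_pair_scale[OF field_embedding_id])
  let ?q = "CARD('k)"
  have q: "?q > 1" using card_mono[of UNIV "{0, 1::'k}"] by simp
  assume "\<not> K.dim W \<le> m"
  then have "?q ^ Suc m \<le> ?q ^ K.dim W" using q by (intro power_increasing) auto
  moreover have sW: "K.subspace W" using W by (simp add: scattered_def)
  ultimately have big: "?q ^ Suc m \<le> card W" using K.card_subspace by simp
  define L where "L = (\<lambda>v. A.span {v} \<inter> W - {0})"
  have L: "card (L v) \<le> ?q - 1" if "v \<noteq> 0" for v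
  proof -
    have "K.subspace (A.span {v})"
      using A.subspace_span[of "{v}"] unfolding K.subspace_def A.subspace_def pair_scale_def
      by simp
    then have "K.subspace (A.span {v} \<inter> W)" using sW by (rule K.subspace_inter)
    then have "card (A.span {v} \<inter> W) = ?q ^ K.dim (A.span {v} \<inter> W)"
      by (rule K.card_subspace) simp
    also have "\<dots> \<le> ?q ^ 1"
    proof (rule power_increasing)
      show "K.dim (A.span {v} \<inter> W) \<le> 1"
        using W that unfolding scattered_def by (elim conjE allE impE)
    qed (use q in simp)
    finally show ?thesis
      using K.subspace_0[OF sW] A.span_zero by (simp add: L_def card_Diff_singleton)
  qed
  \<comment> \<open>The lines through 0 are represented by slopes \<open>(1, s)\<close> and the
    vertical direction \<open>(0, 1)\<close>.\<close>
  have cover: "W - {0} \<subseteq> (\<Union>s. L (1, s)) \<union> L (0, 1)"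
  proof
    fix w assume w: "w \<in> W - {0}"
    obtain x y where xy: "w = (x, y)" by force
    show "w \<in> (\<Union>s. L (1, s)) \<union> L (0, 1)"
    proof (cases "x = 0")
      case True
      then have "w = pair_scale id y (0, 1)" using xy by (simp add: pair_scale_def)
      then show ?thesis using w by (auto simp: L_def A.span_singleton)
    next
      case False
      then have "w = pair_scale id x (1, y / x)" using xy by (simp add: pair_scale_def)
      then show ?thesis using w by (auto simp: L_def A.span_singleton)
    qed
  qed
  have "card W - 1 = card (W - {0})"
    using K.subspace_0[OF sW] by (simp add: card_Diff_singleton)
  also have "\<dots> \<le> card ((\<Union>s. L (1, s)) \<union> L (0, 1))"
    by (rule card_mono[OF _ cover]) simp
  also have "\<dots> \<le> card (\<Union>s. L (1, s)) + card (L (0, 1))"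
    by (rule card_Un_le)
  also have "card (\<Union>s. L (1, s)) \<le> (\<Sum>s\<in>UNIV. card (L (1, s)))"
    by (rule card_UN_le) simp
  also have "\<dots> \<le> (\<Sum>s\<in>(UNIV::'a set). ?q - 1)"
    by (intro sum_mono L) (simp add: zero_prod_def)
  also have "\<dots> = ?q ^ m * (?q - 1)" by (simp add: card)
  also have "card (L (0, 1)) \<le> ?q - 1" by (rule L) (simp add: zero_prod_def)
  finally have "card W - 1 \<le> ?q ^ m * (?q - 1) + (?q - 1)" by simp
  moreover have "?q ^ m * (?q - 1) + ?q ^ m = ?q ^ Suc m"
    using q by (simp add: algebra_simps)
  \<comment> \<open>The count allows only \<open>q ^ Suc m - q ^ m + q - 1\<close> nonzero vectors,
    where \<open>q\<close> is \<open>CARD('k)\<close>. This is less than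
    \<open>q ^ Suc m - 1\<close> since \<open>q < q ^ 2 \<le> q ^ m\<close>; here
    \<open>m \<ge> 2\<close> enters.\<close>
  moreover have "?q ^ 2 \<le> ?q ^ m" using q m by (intro power_increasing) auto
  moreover have "?q < ?q ^ 2" using q by (simp add: power2_eq_square)
  moreover have False if "w - 1 \<le> u + (r - 1)" "u + v = t" "s \<le> v" "r < s" "t \<le> w" "r > 1"
    for u v w r s t :: nat
    using that by linarith
  ultimately show False using big q by blast
qed

section \<open>Scatteredness and dimension of the graph\<close>

theorem theorem7p2:
  fixes q :: nat
    and \<iota> :: "'k::{field,finite} \<Rightarrow> 'a::{field,finite}"
    and b :: 'a
  assumes "primepow q" and "odd q"
    and "CARD('k) = q" and "CARD('a) = q ^ 8"
    and "field_embedding \<iota>"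
    and "b \<noteq> 0" and "b ^ 2 = - 1"
  shows "maximum_scattered \<iota> {(x, b * x ^ q + x ^ (q ^ 5)) | x. True}"
proof -
  interpret K: vector_space "pair_scale \<iota>" by (rule vector_space_pair_scale[OF assms(5)])
  interpret A: vector_space "pair_scale id :: 'a \<Rightarrow> _"
    by (rule vector_space_pair_scale[OF field_embedding_id])
  define \<phi> where "\<phi> = (\<lambda>x::'a. x ^ q)"
  have \<phi>: "field_embedding \<phi>"
    unfolding \<phi>_def by (rule field_embedding_power_card[OF assms(1,4)]) simp
  have iter: "(\<phi> ^^ n) x = x ^ (q ^ n)" for n x
    by (induction n) (simp_all add: \<phi>_def mult.commute flip: power_mult)
  have cyc: "(\<phi> ^^ 8) x = x" for x
    using finite_field_power_CARD[of x] by (simp add: iter assms(4))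
  have two: "(2::'a) \<noteq> 0"
    by (rule two_neq_0_of_odd_card) (simp add: assms(2,4))
  have fixed: "range \<iota> = {x. \<phi> x = x}"
    using range_eq_fixed_points[OF assms(5)]
    by (simp add: \<phi>_def assms(3))
  define f where "f = (\<lambda>x. b * \<phi> x + (\<phi> ^^ 5) x)"
  define U where "U = {(x, b * x ^ q + x ^ (q ^ 5)) | x. True}"
  have "f x = b * x ^ q + x ^ (q ^ 5)" for x
    unfolding f_def iter by (simp add: \<phi>_def)
  then have U: "U = range (\<lambda>x. (x, f x))"
    by (auto simp: U_def)
  have hom: "\<psi> (x + y) = \<psi> x + \<psi> y" "\<psi> (x * y) = \<psi> x * \<psi> y" if "\<psi> = \<phi> \<or> \<psi> = \<phi> ^^ 5" for \<psi> x y
    using that \<phi> field_embedding_funpow[OF \<phi>, of 5] by (auto simp: field_embedding_def)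
  \<comment> \<open>Scalars from the small field are fixed by Frobenius, which makes
    \<open>f\<close> linear over that field.\<close>
  have "\<phi> (\<iota> c) = \<iota> c" for c using fixed by auto
  then have \<phi>\<iota>: "(\<phi> ^^ n) (\<iota> c) = \<iota> c" for n c by (induction n) simp_all
  have f_add: "f (x + y) = f x + f y" for x y
    by (simp add: f_def hom algebra_simps)
  have f_scale: "f (\<iota> c * x) = \<iota> c * f x" for c x
    using \<phi>\<iota>[of 1 c] \<phi>\<iota>[of 5 c] by (simp add: f_def hom algebra_simps)
  have f_0: "f 0 = 0" using f_add[of 0 0] by (metis add.right_neutral add_left_cancel)
  have sub: "K.subspace U"
    by (rule K.subspaceI) (auto simp: U zero_prod_def f_0 pair_scale_def simp flip: f_add f_scale)
  have "K.dim (A.span {v} \<inter> U) \<le> 1" for v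
  proof (cases "A.span {v} \<inter> U \<subseteq> {0}")
    case True
    then have "K.dim (A.span {v} \<inter> U) \<le> card {0 :: 'a \<times> 'a}"
      by (intro K.dim_le_card) (auto intro: K.span_base)
    then show ?thesis by simp
  next
    case False
    then obtain w where w: "w \<in> A.span {v}" "w \<in> U" "w \<noteq> 0" by auto
    then obtain x where x: "w = (x, f x)" by (auto simp: U)
    then have "x \<noteq> 0" using w(3) f_0 by (auto simp: zero_prod_def)
    \<comment> \<open>One nonzero \<open>w\<close> in the intersection spans it: any other
      \<open>z\<close> there is proportional to \<open>w\<close> over the big field, and the factor
      \<open>y / x\<close> lies in \<open>range \<iota>\<close>.\<close>
    have "z \<in> K.span {w}" if z: "z \<in> A.span {v}" "z \<in> U" for z
    proof -
      obtain y where y: "z = (y, f y)" using z(2) by (auto simp: U)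
      obtain c d where c: "w = pair_scale id c v" and d: "z = pair_scale id d v"
        using w(1) z(1) by (auto simp: A.span_singleton)
      have "x = c * fst v" "f x = c * snd v" using arg_cong[OF c, of fst] arg_cong[OF c, of snd] by (simp_all add: x pair_scale_def)
      moreover have "y = d * fst v" "f y = d * snd v" using arg_cong[OF d, of fst] arg_cong[OF d, of snd] by (simp_all add: y pair_scale_def)
      ultimately have "x * f y = y * f x" by simp
      then have "\<phi> (y / x) = y / x"
        unfolding f_def by (rule frobenius_fixes_quotient[OF \<phi> cyc two assms(7) \<open>x \<noteq> 0\<close>])
      then obtain k where "y / x = \<iota> k" using fixed by (metis (mono_tags) mem_Collect_eq rangeE)
      then have "y = \<iota> k * x" using \<open>x \<noteq> 0\<close> by (simp add: field_simps)
      then have "z = pair_scale \<iota> k w" by (simp add: x y f_scale pair_scale_def)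
      then show ?thesis by (auto simp: K.span_singleton)
    qed
    then have "K.dim (A.span {v} \<inter> U) \<le> card {w}"
      by (intro K.dim_le_card) auto
    then show ?thesis by simp
  qed
  then have scat: "scattered \<iota> U" using sub unfolding scattered_def by blast
  \<comment> \<open>A graph has as many points as its domain, and the dimension is read off from
    this cardinality.\<close>
  have "card U = q ^ 8"
    unfolding U by (subst card_image) (auto intro: inj_onI simp: assms(4))
  then have "q ^ K.dim U = q ^ 8"
    using K.card_subspace[OF sub] by (simp add: assms(3))
  then have "K.dim U = 8"
    using primepow_gt_Suc_0[OF assms(1)] by simp
  moreover have "K.dim W \<le> 8" if "scattered \<iota> W" for W
    using scattered_dim_le[OF assms(5) _ _ that, of 8] by (simp add: assms(3,4))
  ultimately have "maximum_scattered \<iota> U"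
    using scat unfolding maximum_scattered_def by simp
  then show ?thesis unfolding U_def .
qed

end
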